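(* Let $G_i$, $1\leq i\leq n$, be just infinite groups. Suppose that at most two of them are virtually abelian. Then every subdirect product $H$ of $\prod_{i=1}^nG_i$ is virtually diagonal by blocks.
   Context: A group is just infinite if it is infinite and all its proper quotients are finite. A subdirect product of $\prod_{i\in I}G_i$ is a subgroup $H\le\prod_{i\in I}G_i$ that projects onto each factor $G_i$. If $(L_i)_{i\in J}$ are groups all isomorphic to a group $L$, a subgroup of $\prod_{i\in J}L_i$ is called diagonal if it equals $\{(\psi_i(g))_{i\in J}\mid g\in L\}$ for some isomorphisms $\psi_i\colon L\to L_i$. A subgroup $H$ of $\prod_{i\in I}G_i$ is virtually diagonal by blocks if there exist a set $\Delta$, a partition $I=\bigsqcup_{\alpha\in\Delta}I_\alpha$, abstract groups $(G_\alpha)_{\alpha\in\Delta}$, finite index subgroups $L_\alpha\le G_\alpha$ and subgroups $D_\alpha\le\prod_{i\in I_\alpha}G_i$ such that: (1) for every $i\in I_\alpha$ the group $G_i$ is isomorphic to $G_\alpha$; (2) $D_\alpha$ is a diagonal subgroup of $L_\alpha^{|I_\alpha|}$, that is, there are finite index subgroups $L_i\le G_i$ isomorphic to $L_\alpha$ ($i\in I_\alpha$) such that $D_\alpha$ is a diagonal subgroup of $\prod_{i\in I_\alpha}L_i$; (3) $H$ contains $\prod_{\alpha\in\Delta}D_\alpha$ as a finite index subgroup. *)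

theory Defs
  imports "HOL-Algebra.Algebra"
begin

definition finite_index_subgroup :: "'a set \<Rightarrow> ('a, 'b) monoid_scheme \<Rightarrow> bool" where
  "finite_index_subgroup H G \<longleftrightarrow> subgroup H G \<and> finite (rcosets\<^bsub>G\<^esub> H)"

definition just_infinite :: "('a, 'b) monoid_scheme \<Rightarrow> bool" where
  "just_infinite G \<longleftrightarrow>
     group G \<and> infinite (carrier G) \<and>
     (\<forall>N. N \<lhd> G \<and> N \<noteq> {\<one>\<^bsub>G\<^esub>} \<longrightarrow> finite (carrier (G Mod N)))"

definition virtually_abelian :: "('a, 'b) monoid_scheme \<Rightarrow> bool" where
  "virtually_abelian G \<longleftrightarrow>
     (\<exists>A. finite_index_subgroup A G \<and> comm_group (G\<lparr>carrier := A\<rparr>))"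

definition subdirect_product ::
    "'i set \<Rightarrow> ('i \<Rightarrow> ('a, 'b) monoid_scheme) \<Rightarrow> ('i \<Rightarrow> 'a) set \<Rightarrow> bool" where
  "subdirect_product I G H \<longleftrightarrow>
     subgroup H (product_group I G) \<and> (\<forall>i\<in>I. (\<lambda>x. x i) ` H = carrier (G i))"

definition diagonal_subgroup ::
    "'i set \<Rightarrow> ('c, 'd) monoid_scheme \<Rightarrow> ('i \<Rightarrow> ('a, 'b) monoid_scheme) \<Rightarrow> ('i \<Rightarrow> 'a) set \<Rightarrow> bool" where
  "diagonal_subgroup J L M D \<longleftrightarrow>
     (\<exists>\<psi>. (\<forall>i\<in>J. \<psi> i \<in> iso L (M i)) \<and> D = (\<lambda>g. \<lambda>i\<in>J. \<psi> i g) ` carrier L)"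

text \<open>The product of subgroups \<open>D \<alpha>\<close> of the block products over \<open>B \<alpha>\<close>, viewed inside the
  product over \<open>I\<close>: if the blocks \<open>B \<alpha>\<close> partition \<open>I\<close>, a tuple lies in it iff its restriction to
  every block \<open>B \<alpha>\<close> lies in \<open>D \<alpha>\<close>.\<close>

definition block_product ::
    "'i set \<Rightarrow> ('i \<Rightarrow> ('a, 'b) monoid_scheme) \<Rightarrow> 'k set \<Rightarrow> ('k \<Rightarrow> 'i set)
      \<Rightarrow> ('k \<Rightarrow> ('i \<Rightarrow> 'a) set) \<Rightarrow> ('i \<Rightarrow> 'a) set" where
  "block_product I G \<Delta> B D =
     {x \<in> carrier (product_group I G). \<forall>\<alpha>\<in>\<Delta>. restrict x (B \<alpha>) \<in> D \<alpha>}"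

text \<open>HOL cannot quantify existentially over types. Since the blocks are nonempty and disjoint, and
  each abstract group \<open>A \<alpha>\<close> is isomorphic to some \<open>G i\<close>, it is no restriction to index the blocks by
  a subset of the type of \<open>I\<close> and to let the groups \<open>A \<alpha>\<close> live on the element type of the
  \<open>G i\<close>.\<close>

definition virtually_diagonal_by_blocks ::
    "'i set \<Rightarrow> ('i \<Rightarrow> ('a, 'b) monoid_scheme) \<Rightarrow> ('i \<Rightarrow> 'a) set \<Rightarrow> bool" where
  "virtually_diagonal_by_blocks I G H \<longleftrightarrow>
     subgroup H (product_group I G) \<and>
     (\<exists>(\<Delta> :: 'i set) (B :: 'i \<Rightarrow> 'i set) (A :: 'i \<Rightarrow> 'a monoid)
        (L :: 'i \<Rightarrow> 'a set) (D :: 'i \<Rightarrow> ('i \<Rightarrow> 'a) set).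
        \<Union> (B ` \<Delta>) = I \<and> disjoint_family_on B \<Delta> \<and> (\<forall>\<alpha>\<in>\<Delta>. B \<alpha> \<noteq> {}) \<and>
        (\<forall>\<alpha>\<in>\<Delta>. group (A \<alpha>) \<and> finite_index_subgroup (L \<alpha>) (A \<alpha>) \<and>
                subgroup (D \<alpha>) (product_group (B \<alpha>) G)) \<and>
        (\<forall>\<alpha>\<in>\<Delta>. \<forall>i\<in>B \<alpha>. G i \<cong> A \<alpha>) \<and>
        (\<forall>\<alpha>\<in>\<Delta>. \<exists>M.
           (\<forall>i\<in>B \<alpha>. finite_index_subgroup (M i) (G i) \<and>
                     (G i)\<lparr>carrier := M i\<rparr> \<cong> (A \<alpha>)\<lparr>carrier := L \<alpha>\<rparr>) \<and>
           diagonal_subgroup (B \<alpha>) ((A \<alpha>)\<lparr>carrier := L \<alpha>\<rparr>) (\<lambda>i. (G i)\<lparr>carrier := M i\<rparr>) (D \<alpha>)) \<and>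
        finite_index_subgroup (block_product I G \<Delta> B D) ((product_group I G)\<lparr>carrier := H\<rparr>))"

end

theory Submission
  imports Defs
begin

text \<open>
  For a set \<open>T\<close> of indices let \<open>K T\<close> be the set of elements of \<open>H\<close> that are trivial on \<open>T\<close>. Its
  image in each just infinite factor is normal, hence trivial or of finite index. Two indices are
  put in the same block if the corresponding projections of \<open>H\<close> have the same kernel; on such a
  block \<open>H\<close> projects to the graph of a family of isomorphisms. All that matters is that for every
  \<open>s\<close> some element of \<open>H\<close> is nontrivial at \<open>s\<close> and trivial outside of the block of \<open>s\<close>: then the
  elements of \<open>H\<close> supported on the single blocks generate a subgroup of finite index.

  If \<open>G s\<close> is not virtually abelian, such an element is obtained as an iterated commutator, since
  two nontrivial normal subgroups of \<open>G s\<close> cannot commute. If \<open>G s\<close> is virtually abelian, there is at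
  most one other block \<open>C\<close> of virtually abelian factors. Infinitely many elements of \<open>H\<close> that are
  trivial on \<open>C\<close> are told apart by their value at \<open>s\<close>, so two of them agree modulo the finite index
  subgroups already found in the other factors; their quotient can be corrected by elements
  supported on the other blocks.
\<close>

section \<open>Cosets and subgroups of finite index\<close>

lemma r_coset_in_rcosets: "x \<in> carrier G \<Longrightarrow> K #>\<^bsub>G\<^esub> x \<in> rcosets\<^bsub>G\<^esub> K"
  by (auto simp: RCOSETS_def)

lemma (in group) r_coset_eq_iff:
  assumes "subgroup K G" "x \<in> carrier G" "y \<in> carrier G"
  shows "K #> x = K #> y \<longleftrightarrow> x \<otimes> inv y \<in> K"
proof -
  have "x \<in> K #> y \<longleftrightarrow> x \<otimes> inv y \<in> K"
    using subgroup.rcos_module[OF assms(1) is_group assms(3,2)] .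
  moreover have "K #> x = K #> y \<longleftrightarrow> x \<in> K #> y"
    using assms rcos_self repr_independence by metis
  ultimately show ?thesis by simp
qed

text \<open>Choosing a preimage of each value of \<open>f\<close> recovers the coset from the value,
  so there are no more cosets than values. Below, \<open>f\<close> collects finitely many cosets
  attached to an element.\<close>

lemma (in group) finite_rcosetsI:
  assumes K: "subgroup K G" and fin: "finite (f ` carrier G)"
    and f: "\<And>x y. \<lbrakk>x \<in> carrier G; y \<in> carrier G; f x = f y\<rbrakk> \<Longrightarrow> x \<otimes> inv y \<in> K"
  shows "finite (rcosets K)"
proof -
  define g where "g c = K #> (SOME x. x \<in> carrier G \<and> f x = c)" for c
  have "K #> x = g (f x)" if x: "x \<in> carrier G" for x
  proof -
    have "(SOME z. z \<in> carrier G \<and> f z = f x) \<in> carrier G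
          \<and> f (SOME z. z \<in> carrier G \<and> f z = f x) = f x"
      by (rule someI[of _ x]) (use x in auto)
    then show ?thesis
      unfolding g_def using r_coset_eq_iff[OF K x] f[OF x] by metis
  qed
  then have "rcosets K \<subseteq> g ` f ` carrier G"
    unfolding RCOSETS_def by auto
  then show ?thesis
    using fin by (meson finite_imageI finite_subset)
qed

lemma (in group) finite_rcosets_Int:
  assumes A: "subgroup A G" and B: "subgroup B G"
    and fA: "finite (rcosets A)" and fB: "finite (rcosets B)"
  shows "finite (rcosets (A \<inter> B))"
proof (rule finite_rcosetsI[where f = "\<lambda>x. (A #> x, B #> x)"])
  show "subgroup (A \<inter> B) G"
    using subgroups_Inter_pair[OF A B] .
  have "(\<lambda>x. (A #> x, B #> x)) ` carrier G \<subseteq> (rcosets A) \<times> (rcosets B)"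
    by (auto simp: RCOSETS_def)
  then show "finite ((\<lambda>x. (A #> x, B #> x)) ` carrier G)"
    using fA fB finite_subset by blast
qed (auto simp: r_coset_eq_iff[OF A] r_coset_eq_iff[OF B])

text \<open>The intersection of \<open>A\<close> and \<open>B\<close> still has finite index, and
  two of its elements commute because one can be read as a member of \<open>A\<close> and the other
  as a member of \<open>B\<close>.\<close>

lemma (in group) virtually_abelian_if_commuting:
  assumes A: "subgroup A G" and B: "subgroup B G"
    and fA: "finite (rcosets A)" and fB: "finite (rcosets B)"
    and comm: "\<And>a b. \<lbrakk>a \<in> A; b \<in> B\<rbrakk> \<Longrightarrow> a \<otimes> b = b \<otimes> a"
  shows "virtually_abelian G"
proof -
  have sub: "subgroup (A \<inter> B) G"
    using subgroups_Inter_pair[OF A B] .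
  have "comm_group (G\<lparr>carrier := A \<inter> B\<rparr>)"
    by (rule group.group_comm_groupI[OF subgroup_imp_group[OF sub]]) (use comm in auto)
  then show ?thesis
    unfolding virtually_abelian_def finite_index_subgroup_def
    using sub finite_rcosets_Int[OF assms(1-4)] by blast
qed

lemma (in group) infinite_if_finite_rcosets:
  assumes K: "subgroup K G" and fin: "finite (rcosets K)" and inf: "infinite (carrier G)"
  shows "infinite K"
proof
  assume "finite K"
  moreover have "finite c" if "c \<in> rcosets K" for c
    using that \<open>finite K\<close> by (auto simp: RCOSETS_def r_coset_def)
  ultimately have "finite (\<Union>(rcosets K))" using fin by blast
  then show False using rcosets_part_G[OF K] inf by simp
qed

lemma just_infinite_finite_rcosets:
  assumes "just_infinite G" "N \<lhd> G" "N \<noteq> {\<one>\<^bsub>G\<^esub>}"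
  shows "finite (rcosets\<^bsub>G\<^esub> N)"
  using assms by (auto simp: just_infinite_def FactGroup_def)

text \<open>The abstract groups in the definition are plain monoid records, whereas
  \<open>G i\<close> may carry further fields. Forgetting these changes neither products nor
  inverses.\<close>

lemma finite_index_truncate:
  "finite_index_subgroup N (monoid.truncate Q) \<longleftrightarrow> finite_index_subgroup N Q"
proof -
  have "inv\<^bsub>monoid.truncate Q\<^esub> x = inv\<^bsub>Q\<^esub> x" for x
    by (simp add: m_inv_def monoid.truncate_def)
  then show ?thesis
    by (simp add: finite_index_subgroup_def subgroup_def RCOSETS_def r_coset_def
        monoid.truncate_def)
qed

section \<open>Coordinatewise calculation in a subdirect product\<close>

locale subdirect_just_infinite =
  fixes I :: "'i set" and G :: "'i \<Rightarrow> ('a, 'b) monoid_scheme" and H :: "('i \<Rightarrow> 'a) set"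
  assumes finite_I: "finite I"
    and just_inf: "i \<in> I \<Longrightarrow> just_infinite (G i)"
    and subdirect: "subdirect_product I G H"
begin

lemma grp: "i \<in> I \<Longrightarrow> group (G i)"
  using just_inf by (simp add: just_infinite_def)

lemma inf: "i \<in> I \<Longrightarrow> infinite (carrier (G i))"
  using just_inf by (simp add: just_infinite_def)

lemma sub: "subgroup H (product_group I G)"
  using subdirect by (simp add: subdirect_product_def)

lemma proj: "i \<in> I \<Longrightarrow> (\<lambda>x. x i) ` H = carrier (G i)"
  using subdirect by (simp add: subdirect_product_def)

lemma H_subset: "H \<subseteq> (\<Pi>\<^sub>E i\<in>I. carrier (G i))"
  using subgroup.subset[OF sub] by simp

lemma H_closed [simp]: "\<lbrakk>h \<in> H; i \<in> I\<rbrakk> \<Longrightarrow> h i \<in> carrier (G i)"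
  using H_subset by auto

text \<open>With \<open>neg\<close> and \<open>triv\<close>, these are the operations of the product
  group, written on functions. Unlike the inverse of \<open>product_group\<close>,
  \<open>neg\<close> can be evaluated at an index without a check of membership in the
  carrier.\<close>

definition mul :: "('i \<Rightarrow> 'a) \<Rightarrow> ('i \<Rightarrow> 'a) \<Rightarrow> 'i \<Rightarrow> 'a" where
  "mul x y = (\<lambda>i\<in>I. x i \<otimes>\<^bsub>G i\<^esub> y i)"

definition neg :: "('i \<Rightarrow> 'a) \<Rightarrow> 'i \<Rightarrow> 'a" where
  "neg x = (\<lambda>i\<in>I. inv\<^bsub>G i\<^esub> x i)"

definition triv :: "'i \<Rightarrow> 'a" where
  "triv = (\<lambda>i\<in>I. \<one>\<^bsub>G i\<^esub>)"

lemma mul_apply [simp]: "i \<in> I \<Longrightarrow> mul x y i = x i \<otimes>\<^bsub>G i\<^esub> y i"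
  by (simp add: mul_def)

lemma neg_apply [simp]: "i \<in> I \<Longrightarrow> neg x i = inv\<^bsub>G i\<^esub> x i"
  by (simp add: neg_def)

lemma triv_apply [simp]: "i \<in> I \<Longrightarrow> triv i = \<one>\<^bsub>G i\<^esub>"
  by (simp add: triv_def)

lemma mul_H: "\<lbrakk>x \<in> H; y \<in> H\<rbrakk> \<Longrightarrow> mul x y \<in> H"
  using subgroup.m_closed[OF sub] by (simp add: mul_def)

lemma neg_H: "x \<in> H \<Longrightarrow> neg x \<in> H"
  using subgroup.m_inv_closed[OF sub, of x] H_subset grp
  by (auto simp: neg_def subset_iff)

lemma triv_H: "triv \<in> H"
  using subgroup.one_closed[OF sub] by (simp add: triv_def)

section \<open>Elements trivial on a set of indices and their images in the factors\<close>

definition K :: "'i set \<Rightarrow> ('i \<Rightarrow> 'a) set" where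
  "K T = {h \<in> H. \<forall>t\<in>T. h t = \<one>\<^bsub>G t\<^esub>}"

lemma K_H: "h \<in> K T \<Longrightarrow> h \<in> H"
  by (simp add: K_def)

lemma K_mul: "\<lbrakk>T \<subseteq> I; x \<in> K T; y \<in> K T\<rbrakk> \<Longrightarrow> mul x y \<in> K T"
  using grp by (auto simp: K_def mul_H subset_iff group.is_monoid)

lemma K_neg: "\<lbrakk>T \<subseteq> I; x \<in> K T\<rbrakk> \<Longrightarrow> neg x \<in> K T"
  using grp by (auto simp: K_def neg_H subset_iff group.is_monoid monoid.inv_one)

lemma K_triv: "T \<subseteq> I \<Longrightarrow> triv \<in> K T"
  by (auto simp: K_def triv_H subset_iff)

lemma K_conj:
  assumes "T \<subseteq> I" "x \<in> H" "k \<in> K T"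
  shows "mul (mul x k) (neg x) \<in> K T"
proof -
  have "x t \<otimes>\<^bsub>G t\<^esub> k t \<otimes>\<^bsub>G t\<^esub> inv\<^bsub>G t\<^esub> x t = \<one>\<^bsub>G t\<^esub>" if "t \<in> T" for t
  proof -
    have "k t = \<one>\<^bsub>G t\<^esub>" "x t \<in> carrier (G t)" "group (G t)"
      using assms that grp by (auto simp: K_def)
    then show ?thesis
      by (simp add: group.is_monoid group.r_inv)
  qed
  then show ?thesis
    using assms by (auto simp: K_def mul_H neg_H subset_iff)
qed

abbreviation M :: "'i \<Rightarrow> 'i set \<Rightarrow> 'a set" where
  "M i T \<equiv> (\<lambda>h. h i) ` K T"

text \<open>Since \<open>H\<close> projects onto \<open>G i\<close>, conjugation in
  \<open>G i\<close> lifts to conjugation by an element of \<open>H\<close>, which preserves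
  \<open>K T\<close>.\<close>

lemma M_normal:
  assumes i: "i \<in> I" and T: "T \<subseteq> I"
  shows "M i T \<lhd> G i"
proof -
  interpret Gi: group "G i" using grp[OF i] .
  have sub: "subgroup (M i T) (G i)"
  proof (rule Gi.subgroupI)
    show "M i T \<subseteq> carrier (G i)" using i by (auto dest: K_H)
    show "M i T \<noteq> {}" using K_triv[OF T] by blast
    fix a assume "a \<in> M i T"
    then obtain x where x: "x \<in> K T" "a = x i" by blast
    show "inv\<^bsub>G i\<^esub> a \<in> M i T"
      using K_neg[OF T x(1)] i x(2) by (intro image_eqI[where x = "neg x"]) auto
    fix b assume "b \<in> M i T"
    then obtain y where y: "y \<in> K T" "b = y i" by blast
    show "a \<otimes>\<^bsub>G i\<^esub> b \<in> M i T"
      using K_mul[OF T x(1) y(1)] i x(2) y(2) by (intro image_eqI[where x = "mul x y"]) auto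
  qed
  show ?thesis
  proof (rule Gi.normal_invI[OF sub])
    fix x k assume "x \<in> carrier (G i)" "k \<in> M i T"
    then obtain h k' where h: "h \<in> H" "x = h i" "k' \<in> K T" "k = k' i"
      using proj[OF i] by blast
    then show "x \<otimes>\<^bsub>G i\<^esub> k \<otimes>\<^bsub>G i\<^esub> inv\<^bsub>G i\<^esub> x \<in> M i T"
      using K_conj[OF T h(1,3)] i by (intro image_eqI[where x = "mul (mul h k') (neg h)"]) auto
  qed
qed

lemma M_subgroup: "\<lbrakk>i \<in> I; T \<subseteq> I\<rbrakk> \<Longrightarrow> subgroup (M i T) (G i)"
  using M_normal normal_imp_subgroup by blast

lemma M_finite_rcosets:
  assumes "i \<in> I" "T \<subseteq> I" "h \<in> K T" "h i \<noteq> \<one>\<^bsub>G i\<^esub>"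
  shows "finite (rcosets\<^bsub>G i\<^esub> (M i T))"
proof (rule just_infinite_finite_rcosets[OF just_inf[OF assms(1)] M_normal[OF assms(1,2)]])
  show "M i T \<noteq> {\<one>\<^bsub>G i\<^esub>}"
    using assms(3,4) by blast
qed

lemma M_infinite:
  assumes "i \<in> I" "T \<subseteq> I" "h \<in> K T" "h i \<noteq> \<one>\<^bsub>G i\<^esub>"
  shows "infinite (M i T)"
  using group.infinite_if_finite_rcosets[OF grp M_subgroup M_finite_rcosets inf] assms by blast

lemma ex_nontrivial:
  assumes "i \<in> I" shows "\<exists>h\<in>H. h i \<noteq> \<one>\<^bsub>G i\<^esub>"
proof (rule ccontr)
  assume "\<not> ?thesis"
  then have "carrier (G i) \<subseteq> {\<one>\<^bsub>G i\<^esub>}"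
    using proj[OF assms] by auto
  then show False using inf[OF assms] finite_subset by blast
qed

lemma quotient_eq_one_iff:
  assumes "x \<in> H" "y \<in> H" "i \<in> I"
  shows "mul x (neg y) i = \<one>\<^bsub>G i\<^esub> \<longleftrightarrow> x i = y i"
proof -
  interpret Gi: group "G i" using grp[OF assms(3)] .
  have "x i \<otimes>\<^bsub>G i\<^esub> inv\<^bsub>G i\<^esub> y i = \<one>\<^bsub>G i\<^esub> \<longleftrightarrow> x i = y i"
    using Gi.inv_solve_right'[of "\<one>\<^bsub>G i\<^esub>" "x i" "y i"] assms by auto
  then show ?thesis using assms(3) by simp
qed

text \<open>Colour an element by the cosets of its coordinates modulo the \<open>N u\<close>. There
  are finitely many colours, but infinitely many values at \<open>s\<close>, so two elements with
  different values at \<open>s\<close> share a colour.\<close>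

lemma pigeonhole_mod_finite_index:
  assumes s: "s \<in> I" and QH: "Q \<subseteq> H" and infQ: "infinite ((\<lambda>h. h s) ` Q)" and UI: "U \<subseteq> I"
    and N: "\<And>u. u \<in> U \<Longrightarrow> subgroup (N u) (G u) \<and> finite (rcosets\<^bsub>G u\<^esub> (N u))"
  shows "\<exists>x\<in>Q. \<exists>y\<in>Q. x s \<noteq> y s \<and> (\<forall>u\<in>U. mul x (neg y) u \<in> N u)"
proof -
  \<comment> \<open>\<open>Z\<close> contains exactly one element of \<open>Q\<close> for each value
    at \<open>s\<close>, so distinct members of \<open>Z\<close> differ at \<open>s\<close>.\<close>
  obtain Z where Z: "Z \<subseteq> Q" "inj_on (\<lambda>h. h s) Z" "(\<lambda>h. h s) ` Z = (\<lambda>h. h s) ` Q"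
    using subset_image_inj[of "(\<lambda>h. h s) ` Q" "\<lambda>h. h s" Q] by auto
  define c where "c x = (\<lambda>u\<in>U. N u #>\<^bsub>G u\<^esub> x u)" for x
  have "infinite Z" using Z(3) infQ finite_imageI by metis
  moreover have "finite (c ` Z)"
  proof (rule finite_subset)
    show "c ` Z \<subseteq> (\<Pi>\<^sub>E u\<in>U. rcosets\<^bsub>G u\<^esub> (N u))"
      using Z(1) QH UI by (auto simp: c_def subset_iff intro!: r_coset_in_rcosets H_closed)
    show "finite (\<Pi>\<^sub>E u\<in>U. rcosets\<^bsub>G u\<^esub> (N u))"
      using N finite_subset[OF UI finite_I] by (intro finite_PiE) auto
  qed
  ultimately have "\<not> inj_on c Z"
    using finite_imageD by blast
  then obtain x y where xy: "x \<in> Z" "y \<in> Z" "c x = c y" "x \<noteq> y"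
    by (auto simp: inj_on_def)
  then have H: "x \<in> H" "y \<in> H" "x s \<noteq> y s" using Z QH by (auto dest: inj_onD)
  have "mul x (neg y) u \<in> N u" if u: "u \<in> U" for u
  proof -
    have "u \<in> I" using u UI by blast
    have "N u #>\<^bsub>G u\<^esub> x u = N u #>\<^bsub>G u\<^esub> y u"
      using fun_cong[OF xy(3), of u] u by (simp add: c_def)
    then show ?thesis
      using group.r_coset_eq_iff[OF grp[OF \<open>u \<in> I\<close>], of "N u" "x u" "y u"] N[OF u] H \<open>u \<in> I\<close>
      by simp
  qed
  then show ?thesis using xy Z(1) H(3) by blast
qed

section \<open>Blocks of indices with equal kernels\<close>

definition same :: "'i \<Rightarrow> 'i \<Rightarrow> bool" where
  "same i j \<longleftrightarrow> (\<forall>h\<in>H. h i = \<one>\<^bsub>G i\<^esub> \<longleftrightarrow> h j = \<one>\<^bsub>G j\<^esub>)"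

definition block :: "'i \<Rightarrow> 'i set" where
  "block i = {j \<in> I. same i j}"

text \<open>Equality of the kernels is applied to the quotient of \<open>x\<close> and
  \<open>y\<close>. Hence one coordinate of an element of \<open>H\<close> determines its
  coordinates on the whole block.\<close>

lemma same_eq: "\<lbrakk>same i j; i \<in> I; j \<in> I; x \<in> H; y \<in> H\<rbrakk> \<Longrightarrow> x i = y i \<longleftrightarrow> x j = y j"
  using quotient_eq_one_iff mul_H neg_H unfolding same_def by metis

lemma block_subset: "block i \<subseteq> I"
  by (auto simp: block_def)

lemma block_self: "i \<in> I \<Longrightarrow> i \<in> block i"
  by (simp add: block_def same_def)

lemma block_eq: "j \<in> block i \<Longrightarrow> block j = block i"
  by (auto simp: block_def same_def)

section \<open>Separation of indices and of blocks\<close>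

text \<open>If the kernel at \<open>j\<close> were contained in the kernel at \<open>i\<close>, then
  \<open>G i\<close> would be a proper quotient of the just infinite group \<open>G j\<close>, hence
  finite. The proof runs this argument on elements of \<open>H\<close>.\<close>

lemma separate:
  assumes i: "i \<in> I" and j: "j \<in> I" and ns: "\<not> same i j"
  shows "\<exists>h\<in>K {j}. h i \<noteq> \<one>\<^bsub>G i\<^esub>"
proof (rule ccontr)
  assume "\<not> ?thesis"
  then have *: "\<And>h. \<lbrakk>h \<in> H; h j = \<one>\<^bsub>G j\<^esub>\<rbrakk> \<Longrightarrow> h i = \<one>\<^bsub>G i\<^esub>"
    by (auto simp: K_def)
  then obtain h where h: "h \<in> K {i}" "h j \<noteq> \<one>\<^bsub>G j\<^esub>"
    using ns by (auto simp: same_def K_def)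
  have Nj: "subgroup (M j {i}) (G j)" "finite (rcosets\<^bsub>G j\<^esub> (M j {i}))"
    using M_subgroup[OF j] M_finite_rcosets[OF j _ h] i by auto
  have "\<exists>x\<in>H. \<exists>y\<in>H. x i \<noteq> y i \<and> (\<forall>u\<in>{j}. mul x (neg y) u \<in> M j {i})"
    by (rule pigeonhole_mod_finite_index[OF i]) (use proj[OF i] inf[OF i] Nj j in auto)
  then obtain x y where xy: "x \<in> H" "y \<in> H" "x i \<noteq> y i" "mul x (neg y) j \<in> M j {i}"
    by auto
  then obtain k where k: "k \<in> H" "k i = \<one>\<^bsub>G i\<^esub>" "mul x (neg y) j = k j"
    by (auto simp: K_def)
  \<comment> \<open>At \<open>j\<close> the quotient of \<open>x\<close> and \<open>y\<close> agrees
    with \<open>k\<close>, which is trivial at \<open>i\<close>. Dividing by \<open>k\<close> gives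
    an element trivial at \<open>j\<close> whose value at \<open>i\<close> is still nontrivial,
    against \<open>*\<close>.\<close>
  have q: "mul x (neg y) \<in> H" using xy mul_H neg_H by blast
  then have "mul (mul x (neg y)) (neg k) i = \<one>\<^bsub>G i\<^esub>"
    using * quotient_eq_one_iff[OF q k(1) j] k(3) mul_H neg_H k(1) by blast
  then show False
    using quotient_eq_one_iff[OF q k(1) i] quotient_eq_one_iff[OF xy(1,2) i] k(2) xy(3) by simp
qed

text \<open>Induction on \<open>T\<close>: a commutator of an element trivial on \<open>T\<close>
  with one trivial at \<open>t\<close> is trivial on both. The images of \<open>K T\<close> and
  \<open>K {t}\<close> have finite index in \<open>G s\<close>, so they cannot commute elementwise,
  and some commutator survives at \<open>s\<close>.\<close>

lemma separate_set_non_virtually_abelian: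
  assumes s: "s \<in> I" and nva: "\<not> virtually_abelian (G s)"
    and T: "finite T" "T \<subseteq> I" "\<And>t. t \<in> T \<Longrightarrow> \<not> same s t"
  shows "\<exists>h\<in>K T. h s \<noteq> \<one>\<^bsub>G s\<^esub>"
  using T
proof (induction T)
  case empty
  then show ?case using ex_nontrivial[OF s] by (simp add: K_def)
next
  case (insert t T)
  interpret Gs: group "G s" using grp[OF s] .
  obtain a where a: "a \<in> K T" "a s \<noteq> \<one>\<^bsub>G s\<^esub>" using insert by auto
  obtain b where b: "b \<in> K {t}" "b s \<noteq> \<one>\<^bsub>G s\<^esub>"
    using separate[OF s, of t] insert.prems by auto
  have t: "t \<in> I" and T: "T \<subseteq> I" using insert.prems by auto
  then have "\<not> (\<forall>x\<in>M s T. \<forall>y\<in>M s {t}. x \<otimes>\<^bsub>G s\<^esub> y = y \<otimes>\<^bsub>G s\<^esub> x)"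
    using nva Gs.virtually_abelian_if_commuting[of "M s T" "M s {t}"]
      M_subgroup[OF s] M_finite_rcosets[OF s _ a] M_finite_rcosets[OF s _ b] by auto
  then obtain x y where xy: "x \<in> K T" "y \<in> K {t}" "x s \<otimes>\<^bsub>G s\<^esub> y s \<noteq> y s \<otimes>\<^bsub>G s\<^esub> x s"
    by auto
  have H: "x \<in> H" "y \<in> H" using xy K_H by auto
  \<comment> \<open>The commutator of \<open>x\<close> and \<open>y\<close>, in a form whose
    triviality at an index says that \<open>x\<close> and \<open>y\<close> commute there.\<close>
  let ?h = "mul (mul x y) (neg (mul y x))"
  have "?h r = \<one>\<^bsub>G r\<^esub>" if "r \<in> insert t T" for r
  proof -
    have r: "r \<in> I" using that t T by auto
    have "x r = \<one>\<^bsub>G r\<^esub> \<or> y r = \<one>\<^bsub>G r\<^esub>" using that xy by (auto simp: K_def)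
    then have "mul x y r = mul y x r"
      using r H grp[OF r] by (auto simp: group.is_monoid)
    then show ?thesis using quotient_eq_one_iff mul_H H r by blast
  qed
  then have "?h \<in> K (insert t T)" using H mul_H neg_H by (simp add: K_def)
  moreover have "?h s \<noteq> \<one>\<^bsub>G s\<^esub>"
    using quotient_eq_one_iff[OF mul_H mul_H s] H xy(3) s by simp
  ultimately show ?case by blast
qed

text \<open>Elements supported on different blocks have disjoint supports, so their product takes
  the prescribed values on each block. Here \<open>x\<close> is an arbitrary function; in the final
  argument its membership in \<open>H\<close> is a consequence.\<close>

lemma assemble_blocks:
  assumes "finite V" "V \<subseteq> I"
    and "\<And>v. v \<in> V \<Longrightarrow> \<exists>k\<in>K (I - block v). \<forall>j\<in>block v. k j = x j"
  shows "\<exists>h\<in>H. \<forall>j\<in>I. h j = (if j \<in> \<Union>(block ` V) then x j else \<one>\<^bsub>G j\<^esub>)"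
  using assms
proof (induction V)
  case empty
  then show ?case using triv_H by (intro bexI[of _ triv]) auto
next
  case (insert v V)
  obtain h where h: "h \<in> H" "\<And>j. j \<in> I \<Longrightarrow> h j = (if j \<in> \<Union>(block ` V) then x j else \<one>\<^bsub>G j\<^esub>)"
    using insert.IH insert.prems by blast
  show ?case
  proof (cases "v \<in> \<Union>(block ` V)")
    \<comment> \<open>\<open>V\<close> may contain several indices of one block; then the block of
      \<open>v\<close> is already covered and \<open>h\<close> still works.\<close>
    case True
    then obtain w where "w \<in> V" "block v = block w" using block_eq by blast
    then have "\<Union>(block ` insert v V) = \<Union>(block ` V)" by blast
    then show ?thesis using h by metis
  next
    case False
    have disj: "j \<notin> \<Union>(block ` V)" if "j \<in> block v" for j
    proof
      assume "j \<in> \<Union>(block ` V)"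
      then obtain w where w: "w \<in> V" "j \<in> block w" by blast
      then have "block v = block w" using block_eq[OF that] block_eq[OF w(2)] by simp
      then show False using False w(1) block_self[of v] insert.prems(1) by blast
    qed
    obtain k where k: "k \<in> K (I - block v)" "\<And>j. j \<in> block v \<Longrightarrow> k j = x j"
      using insert.prems(2)[of v] by blast
    have kH: "k \<in> H" using k(1) K_H by blast
    have "mul h k j = (if j \<in> \<Union>(block ` insert v V) then x j else \<one>\<^bsub>G j\<^esub>)" if j: "j \<in> I" for j
    proof (cases "j \<in> block v")
      case True
      then have "h j = \<one>\<^bsub>G j\<^esub>" using h(2)[OF j] disj by auto
      then show ?thesis
        using True k(2)[OF True] j H_closed[OF kH j] grp[OF j] by (simp add: group.is_monoid)
    next
      case False
      then have "k j = \<one>\<^bsub>G j\<^esub>" using k(1) j by (auto simp: K_def)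
      then show ?thesis
        using False j H_closed[OF h(1) j] grp[OF j] h(2)[OF j] by (simp add: group.is_monoid)
    qed
    then show ?thesis using mul_H[OF h(1) kH] by (intro bexI[of _ "mul h k"] ballI)
  qed
qed

text \<open>The commutator argument is run at \<open>u\<close>, avoiding all indices outside the
  block. Nontriviality then passes to \<open>s\<close> because the kernels at \<open>u\<close> and
  \<open>s\<close> agree.\<close>

lemma separate_block_non_virtually_abelian:
  assumes s: "s \<in> I" and u: "u \<in> block s" and nva: "\<not> virtually_abelian (G u)"
  shows "\<exists>h\<in>K (I - block s). h s \<noteq> \<one>\<^bsub>G s\<^esub>"
proof -
  have uI: "u \<in> I" using u block_subset by blast
  have "\<not> same u t" if "t \<in> I - block u" for t
    using that by (simp add: block_def)
  then obtain h where h: "h \<in> K (I - block u)" "h u \<noteq> \<one>\<^bsub>G u\<^esub>"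
    using separate_set_non_virtually_abelian[OF uI nva, of "I - block u"] finite_I by blast
  moreover have "same s u" using u by (simp add: block_def)
  ultimately have "h s \<noteq> \<one>\<^bsub>G s\<^esub>" using h K_H by (simp add: same_def)
  then show ?thesis using h(1) unfolding block_eq[OF u] by blast
qed

text \<open>Makes the elements of \<open>H\<close> supported on one block project to finite index
  subgroups of the factors of that block. If these factors are virtually abelian, commutators may
  all vanish; the bound of two leaves at most one index to avoid directly, and the remaining blocks
  are cleared by a correction.\<close>

lemma separate_block:
  assumes s: "s \<in> I" and va2: "card {i \<in> I. virtually_abelian (G i)} \<le> 2"
  shows "\<exists>h\<in>K (I - block s). h s \<noteq> \<one>\<^bsub>G s\<^esub>"
proof (cases "\<exists>u\<in>block s. \<not> virtually_abelian (G u)")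
  case True
  then show ?thesis using separate_block_non_virtually_abelian[OF s] by blast
next
  case False
  define W where "W = {i \<in> I - block s. virtually_abelian (G i)}"
  define U where "U = {i \<in> I. \<not> virtually_abelian (G i)}"
  have WI: "W \<subseteq> I" and UI: "U \<subseteq> I" by (auto simp: W_def U_def)
  have "insert s W \<subseteq> {i \<in> I. virtually_abelian (G i)}" "s \<notin> W" "finite W"
    using s False block_self finite_I by (auto simp: W_def)
  then have "card W \<le> 1"
    using card_mono[of "{i \<in> I. virtually_abelian (G i)}" "insert s W"] finite_I va2 by auto
  then consider "W = {}" | t where "W = {t}"
    using \<open>finite W\<close> by (metis One_nat_def card_0_eq card_1_singletonE le_Suc_eq le_zero_eq)
  then have "\<exists>h\<in>K W. h s \<noteq> \<one>\<^bsub>G s\<^esub>"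
  proof cases
    case 1
    then show ?thesis using ex_nontrivial[OF s] by (simp add: K_def)
  next
    case 2
    then have "t \<in> I" "\<not> same s t" by (auto simp: W_def block_def)
    then show ?thesis using separate[OF s] 2 by simp
  qed
  then have infW: "infinite (M s W)" using M_infinite[OF s WI] by blast
  \<comment> \<open>For \<open>u\<close> in \<open>U\<close> the elements supported on the block of
    \<open>u\<close> already have an image of finite index, so the pigeonhole principle applies to
    these images.\<close>
  have "\<exists>x\<in>K W. \<exists>y\<in>K W. x s \<noteq> y s \<and> (\<forall>u\<in>U. mul x (neg y) u \<in> M u (I - block u))"
  proof (rule pigeonhole_mod_finite_index[OF s _ infW UI])
    show "K W \<subseteq> H" by (auto dest: K_H)
    fix u assume "u \<in> U"
    then have u: "u \<in> I" "\<not> virtually_abelian (G u)" by (auto simp: U_def)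
    then show "subgroup (M u (I - block u)) (G u) \<and> finite (rcosets\<^bsub>G u\<^esub> (M u (I - block u)))"
      using M_subgroup M_finite_rcosets block_self separate_block_non_virtually_abelian
      by (meson Diff_subset)
  qed
  then obtain x y where xy: "x \<in> K W" "y \<in> K W" "x s \<noteq> y s"
      "\<And>u. u \<in> U \<Longrightarrow> mul x (neg y) u \<in> M u (I - block u)"
    by auto
  define q where "q = mul x (neg y)"
  have q: "q \<in> K W" "q s \<noteq> \<one>\<^bsub>G s\<^esub>"
    using K_mul[OF WI xy(1) K_neg[OF WI xy(2)]] quotient_eq_one_iff[OF _ _ s] xy K_H
    by (auto simp: q_def)
  have "\<exists>k\<in>K (I - block u). \<forall>j\<in>block u. k j = q j" if u: "u \<in> U" for u
  proof -
    obtain k where k: "k \<in> K (I - block u)" "q u = k u"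
      using xy(4)[OF u] by (auto simp: q_def)
    have "k j = q j" if "j \<in> block u" for j
      using that same_eq[of u j k q] k K_H q(1) u UI by (auto simp: block_def)
    then show ?thesis using k(1) by blast
  qed
  \<comment> \<open>\<open>h\<close> copies \<open>q\<close> on all blocks meeting \<open>U\<close>
    and is trivial elsewhere. It is the correction by which \<open>q\<close> gets divided.\<close>
  then obtain h where h: "h \<in> H"
      "\<And>j. j \<in> I \<Longrightarrow> h j = (if j \<in> \<Union>(block ` U) then q j else \<one>\<^bsub>G j\<^esub>)"
    using assemble_blocks[OF finite_subset[OF UI finite_I] UI, of q] by blast
  \<comment> \<open>This ensures that the correction leaves the value of \<open>q\<close> at
    \<open>s\<close> unchanged.\<close>
  have "s \<notin> \<Union>(block ` U)"
  proof
    assume "s \<in> \<Union>(block ` U)"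
    then obtain u where u: "u \<in> U" "s \<in> block u" by blast
    then have "u \<in> block s" using block_eq[OF u(2)] block_self UI by blast
    then show False using False u(1) by (auto simp: U_def)
  qed
  then have "mul q (neg h) s \<noteq> \<one>\<^bsub>G s\<^esub>"
    using quotient_eq_one_iff[OF K_H[OF q(1)] h(1) s] q(2) h(2)[OF s] by simp
  moreover have "mul q (neg h) j = \<one>\<^bsub>G j\<^esub>" if j: "j \<in> I - block s" for j
  proof -
    have "q j = h j"
    proof (cases "j \<in> \<Union>(block ` U)")
      case True
      then show ?thesis using h(2)[of j] j by simp
    next
      case F: False
      then have "j \<notin> U" using block_self j by blast
      then have "j \<in> W" using j by (auto simp: U_def W_def)
      then show ?thesis using q(1) h(2)[of j] j F by (auto simp: K_def)
    qed
    then show ?thesis using quotient_eq_one_iff[OF K_H[OF q(1)] h(1)] j by blast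
  qed
  ultimately show ?thesis
    using mul_H neg_H K_H[OF q(1)] h(1) by (intro bexI[of _ "mul q (neg h)"]) (auto simp: K_def)
qed

section \<open>Isomorphisms between the factors of a block\<close>

text \<open>For \<open>j\<close> in the block of \<open>i\<close> and \<open>g\<close> in
  \<open>G i\<close>, the value at \<open>j\<close> is the same for every choice of
  \<open>h\<close>, by \<open>same_eq\<close>.\<close>

definition transport :: "'i \<Rightarrow> 'i \<Rightarrow> 'a \<Rightarrow> 'a" where
  "transport i j g = (SOME h. h \<in> H \<and> h i = g) j"

lemma transport_eq:
  assumes "i \<in> I" "j \<in> block i" "h \<in> H"
  shows "transport i j (h i) = h j"
proof -
  define k where "k = (SOME k. k \<in> H \<and> k i = h i)"
  have "k \<in> H \<and> k i = h i"
    unfolding k_def by (rule someI[of _ h]) (use assms in auto)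
  then have "k j = h j"
    using same_eq[of i j k h] assms by (auto simp: block_def)
  then show ?thesis by (simp add: transport_def k_def)
qed

text \<open>Multiplicativity comes from transporting the coordinates of \<open>mul x y\<close>.
  Taking \<open>Z\<close> to be \<open>H\<close> gives isomorphisms of whole factors; taking the
  elements supported on the block gives those of the finite index subgroups.\<close>

lemma transport_iso:
  assumes i: "i \<in> I" and j: "j \<in> block i" and Z: "Z \<subseteq> H"
  shows "transport i j \<in> iso ((G i)\<lparr>carrier := (\<lambda>h. h i) ` Z\<rparr>) ((G j)\<lparr>carrier := (\<lambda>h. h j) ` Z\<rparr>)"
proof -
  have jI: "j \<in> I" and s: "same i j" using j by (auto simp: block_def)
  have t: "transport i j (h i) = h j" if "h \<in> H" for h
    using transport_eq[OF i j that] .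
  have m: "transport i j (x i \<otimes>\<^bsub>G i\<^esub> y i) = x j \<otimes>\<^bsub>G j\<^esub> y j" if "x \<in> Z" "y \<in> Z" for x y
    using t[of "mul x y"] mul_H that Z i jI by (auto simp: subset_iff)
  have im: "transport i j ` (\<lambda>h. h i) ` Z = (\<lambda>h. h j) ` Z"
    unfolding image_image using t Z by (intro image_cong) auto
  have inj: "inj_on (transport i j) ((\<lambda>h. h i) ` Z)"
    using t Z same_eq[OF s i jI] by (auto simp: inj_on_def subset_iff)
  show ?thesis
    using im inj m t Z by (auto simp: iso_def bij_betw_def hom_def subset_iff)
qed

lemma transport_iso_carrier:
  assumes "i \<in> I" "j \<in> block i"
  shows "transport i j \<in> iso (G i) (G j)"
  using transport_iso[OF assms subset_refl] proj assms block_subset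
  by (simp add: subset_iff)

lemma block_restriction_subgroup:
  assumes T: "T \<subseteq> I" and B: "B \<subseteq> I"
  shows "subgroup ((\<lambda>h. restrict h B) ` K T) (product_group B G)"
proof -
  have Bg: "\<And>i. i \<in> B \<Longrightarrow> group (G i)" using grp B by blast
  interpret P: group "product_group B G" using product_group[OF Bg] .
  have cl: "(\<lambda>h. restrict h B) ` K T \<subseteq> carrier (product_group B G)"
    using B by (auto dest!: K_H simp: subset_iff)
  show ?thesis
  proof (rule P.subgroupI[OF cl])
    show "(\<lambda>h. restrict h B) ` K T \<noteq> {}" using K_triv[OF T] by blast
    fix a assume a: "a \<in> (\<lambda>h. restrict h B) ` K T"
    then obtain h where h: "h \<in> K T" "a = restrict h B" by blast
    have "inv\<^bsub>product_group B G\<^esub> a = restrict (neg h) B"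
      using a cl h(2) B Bg by (subst inv_product_group) (auto simp: subset_iff restrict_def)
    then show "inv\<^bsub>product_group B G\<^esub> a \<in> (\<lambda>h. restrict h B) ` K T"
      using K_neg[OF T h(1)] by blast
    fix b assume "b \<in> (\<lambda>h. restrict h B) ` K T"
    then obtain k where k: "k \<in> K T" "b = restrict k B" by blast
    have "a \<otimes>\<^bsub>product_group B G\<^esub> b = restrict (mul h k) B"
      using h k B by (auto simp: subset_iff restrict_def)
    then show "a \<otimes>\<^bsub>product_group B G\<^esub> b \<in> (\<lambda>h. restrict h B) ` K T"
      using K_mul[OF T h(1) k(1)] by blast
  qed
qed

section \<open>The virtually diagonal decomposition\<close>

lemma virtually_diagonal:
  assumes va2: "card {i \<in> I. virtually_abelian (G i)} \<le> 2"
  shows "virtually_diagonal_by_blocks I G H"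
proof -
  \<comment> \<open>The choice depends only on the block, so \<open>rep\<close> is constant on
    blocks and its range \<open>\<Delta>\<close> contains one index of each block.\<close>
  define rep where "rep i = (SOME j. j \<in> block i)" for i
  have rep: "rep i \<in> block i" if "i \<in> I" for i
    unfolding rep_def using block_self[OF that] by (rule someI)
  have rep_cong: "rep i = rep j" if "block i = block j" for i j
    using that by (simp add: rep_def)
  define \<Delta> where "\<Delta> = rep ` I"
  have \<Delta>I: "\<Delta> \<subseteq> I" using rep block_subset by (auto simp: \<Delta>_def)
  have cover: "\<Union>(block ` \<Delta>) = I"
    using rep block_eq block_self block_subset by (fastforce simp: \<Delta>_def)
  have rep_fix: "rep a = a" if a: "a \<in> \<Delta>" for a
  proof -
    obtain i where i: "i \<in> I" "a = rep i" using a by (auto simp: \<Delta>_def)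
    then have "block a = block i" using block_eq[OF rep[OF i(1)]] by simp
    then have "rep a = rep i" by (rule rep_cong)
    then show ?thesis using i(2) by (rule trans[OF _ sym])
  qed
  have disj: "disjoint_family_on block \<Delta>"
    unfolding disjoint_family_on_def
  proof (intro ballI impI equals0I)
    fix a b j assume ab: "a \<in> \<Delta>" "b \<in> \<Delta>" "a \<noteq> b" and "j \<in> block a \<inter> block b"
    then have "block a = block b" using block_eq[of j a] block_eq[of j b] by simp
    then show False using rep_cong[of a b] rep_fix ab by simp
  qed
  \<comment> \<open>The witnesses: the abstract group \<open>A a\<close> is a copy of
    \<open>G a\<close> at the representative, with finite index subgroup \<open>P a a\<close>, and
    \<open>D a\<close> is the restriction to the block of the elements of \<open>H\<close> supported
    there.\<close>
  define N where "N a = K (I - block a)" for a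
  define D where "D a = (\<lambda>h. restrict h (block a)) ` N a" for a
  define P where "P a i = (\<lambda>h. h i) ` N a" for a i
  define A where "A a = monoid.truncate (G a)" for a
  have NH: "N a \<subseteq> H" for a by (auto simp: N_def dest: K_H)
  have fin: "finite_index_subgroup (P a i) (G i)" if a: "a \<in> \<Delta>" and i: "i \<in> block a" for a i
  proof -
    have iI: "i \<in> I" using i block_subset by blast
    obtain h where "h \<in> K (I - block i)" "h i \<noteq> \<one>\<^bsub>G i\<^esub>"
      using separate_block[OF iI va2] by blast
    then show ?thesis
      using M_subgroup[OF iI] M_finite_rcosets[OF iI] block_eq[OF i]
      by (auto simp: finite_index_subgroup_def P_def N_def)
  qed
  have grpA: "group (A a)" if "a \<in> \<Delta>" for a
  proof -
    interpret group "G a" using grp \<Delta>I that by blast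
    show ?thesis
      by (rule groupI) (auto simp: A_def monoid.truncate_def m_assoc intro: l_inv_ex)
  qed
  have isoA: "G i \<cong> A a" if "a \<in> \<Delta>" "i \<in> block a" for a i
  proof -
    have "(\<lambda>x. x) \<in> iso (G a) (A a)"
      by (auto simp: iso_def hom_def A_def monoid.truncate_def bij_betw_def)
    moreover have "inv_into (carrier (G a)) (transport a i) \<in> iso (G i) (G a)"
      using transport_iso_carrier[of a i] that \<Delta>I grp group.iso_set_sym by blast
    ultimately show ?thesis
      unfolding is_iso_def using iso_set_trans by blast
  qed
  have psi: "transport a i \<in> iso ((A a)\<lparr>carrier := P a a\<rparr>) ((G i)\<lparr>carrier := P a i\<rparr>)"
    if "a \<in> \<Delta>" "i \<in> block a" for a i
    using transport_iso[of a i "N a"] that \<Delta>I NH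
    by (auto simp: P_def A_def monoid.truncate_def iso_def hom_def)
  have D_eq: "D a = (\<lambda>g. \<lambda>i\<in>block a. transport a i g) ` P a a" if a: "a \<in> \<Delta>" for a
    unfolding D_def P_def image_image
  proof (intro image_cong refl restrict_ext)
    fix h i assume "h \<in> N a" "i \<in> block a"
    moreover have "h \<in> H" "a \<in> I" using calculation NH a \<Delta>I by blast+
    ultimately show "h i = transport a i (h a)" using transport_eq by simp
  qed
  have diag: "\<exists>M. (\<forall>i\<in>block a. finite_index_subgroup (M i) (G i) \<and>
          (G i)\<lparr>carrier := M i\<rparr> \<cong> (A a)\<lparr>carrier := P a a\<rparr>) \<and>
          diagonal_subgroup (block a) ((A a)\<lparr>carrier := P a a\<rparr>) (\<lambda>i. (G i)\<lparr>carrier := M i\<rparr>) (D a)"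
    if a: "a \<in> \<Delta>" for a
  proof -
    have sub: "subgroup (P a a) (A a)"
      using fin[OF a block_self] a \<Delta>I finite_index_truncate[of "P a a" "G a"]
      by (auto simp: finite_index_subgroup_def A_def)
    have "(G i)\<lparr>carrier := P a i\<rparr> \<cong> (A a)\<lparr>carrier := P a a\<rparr>" if "i \<in> block a" for i
      using psi[OF a that] group.iso_sym[OF group.subgroup_imp_group[OF grpA[OF a] sub]]
      by (auto simp: is_iso_def)
    moreover have "diagonal_subgroup (block a) ((A a)\<lparr>carrier := P a a\<rparr>)
        (\<lambda>i. (G i)\<lparr>carrier := P a i\<rparr>) (D a)"
      unfolding diagonal_subgroup_def using psi[OF a] D_eq[OF a]
      by (intro exI[of _ "transport a"]) auto
    ultimately show ?thesis
      using fin[OF a] by blast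
  qed
  define F where "F = block_product I G \<Delta> block D"
  \<comment> \<open>Membership in the block product is thus tested within \<open>H\<close> and at
    representatives only. In one direction the block components are multiplied together in
    \<open>H\<close>; in the other, agreement at \<open>a\<close> spreads over the block of
    \<open>a\<close>.\<close>
  have F_iff: "x \<in> F \<longleftrightarrow> x \<in> H \<and> (\<forall>a\<in>\<Delta>. x a \<in> P a a)" for x
  proof
    assume x: "x \<in> F"
    then have xc: "x \<in> (\<Pi>\<^sub>E i\<in>I. carrier (G i))"
      and xD: "\<And>a. a \<in> \<Delta> \<Longrightarrow> restrict x (block a) \<in> D a"
      by (auto simp: F_def block_product_def)
    have k: "\<exists>k\<in>N a. \<forall>j\<in>block a. k j = x j" if a: "a \<in> \<Delta>" for a
    proof -
      obtain k where k: "k \<in> N a" "restrict x (block a) = restrict k (block a)"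
        using xD[OF a] by (auto simp: D_def)
      have "k j = x j" if "j \<in> block a" for j
        using fun_cong[OF k(2), of j] that by simp
      then show ?thesis using k(1) by blast
    qed
    then obtain h where h: "h \<in> H" "\<And>j. j \<in> I \<Longrightarrow> h j = x j"
      using assemble_blocks[OF finite_subset[OF \<Delta>I finite_I] \<Delta>I, of x] cover
      by (auto simp: N_def)
    \<comment> \<open>Both functions are \<open>undefined\<close> outside \<open>I\<close>, so
      agreement on \<open>I\<close> suffices.\<close>
    then have "h = x"
      using xc H_subset by (intro PiE_ext[of h I "\<lambda>i. carrier (G i)" x]) auto
    moreover have "x a \<in> P a a" if a: "a \<in> \<Delta>" for a
    proof -
      obtain k where "k \<in> N a" "\<forall>j\<in>block a. k j = x j" using k[OF a] by blast
      moreover have "a \<in> block a" using block_self a \<Delta>I by blast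
      ultimately show ?thesis unfolding P_def by (intro image_eqI[of _ _ k]) simp_all
    qed
    ultimately show "x \<in> H \<and> (\<forall>a\<in>\<Delta>. x a \<in> P a a)" using h(1) by blast
  next
    assume x: "x \<in> H \<and> (\<forall>a\<in>\<Delta>. x a \<in> P a a)"
    have "restrict x (block a) \<in> D a" if a: "a \<in> \<Delta>" for a
    proof -
      obtain k where k: "k \<in> N a" "x a = k a" using x a by (auto simp: P_def)
      then have "restrict x (block a) = restrict k (block a)"
        using same_eq[of a _ x k] x NH a \<Delta>I by (intro restrict_ext) (auto simp: block_def)
      then show ?thesis using k(1) by (auto simp: D_def)
    qed
    then show "x \<in> F" using x H_subset by (auto simp: F_def block_product_def)
  qed
  let ?H = "(product_group I G)\<lparr>carrier := H\<rparr>"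
  interpret PG: group "product_group I G" using product_group[OF grp] .
  interpret HG: group ?H using PG.subgroup_imp_group[OF sub] .
  have inv_H: "inv\<^bsub>?H\<^esub> x = neg x" if "x \<in> H" for x
    using PG.m_inv_consistent[OF sub that] inv_product_group[of x I G] that H_subset grp
    by (auto simp: neg_def subset_iff)
  have mul_eq: "x \<otimes>\<^bsub>?H\<^esub> y = mul x y" for x y by (simp add: mul_def)
  have Psub: "subgroup (P a a) (G a)" "finite (rcosets\<^bsub>G a\<^esub> (P a a))" if "a \<in> \<Delta>" for a
    using fin[OF that block_self] that \<Delta>I by (auto simp: finite_index_subgroup_def)
  have subF: "subgroup F ?H"
  proof (rule HG.subgroupI)
    show "F \<subseteq> carrier ?H" using F_iff by auto
    have "triv a \<in> P a a" if "a \<in> \<Delta>" for a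
      using subgroup.one_closed[OF Psub(1)[OF that]] that \<Delta>I by (simp add: subset_iff)
    then show "F \<noteq> {}" using F_iff triv_H by blast
    show "inv\<^bsub>?H\<^esub> x \<in> F" if "x \<in> F" for x
      using that \<Delta>I subgroup.m_inv_closed[OF Psub(1)] by (auto simp: F_iff inv_H neg_H subset_iff)
    show "x \<otimes>\<^bsub>?H\<^esub> y \<in> F" if "x \<in> F" "y \<in> F" for x y
      unfolding mul_eq
      using that \<Delta>I subgroup.m_closed[OF Psub(1)] by (auto simp: F_iff mul_H subset_iff)
  qed
  have "finite (rcosets\<^bsub>?H\<^esub> F)"
  \<comment> \<open>By \<open>F_iff\<close>, the cosets of the coordinates at the finitely many
    representatives determine the coset of \<open>F\<close>.\<close>
  proof (rule HG.finite_rcosetsI[OF subF, where f = "\<lambda>x. \<lambda>a\<in>\<Delta>. P a a #>\<^bsub>G a\<^esub> x a"])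
    show "finite ((\<lambda>x. \<lambda>a\<in>\<Delta>. P a a #>\<^bsub>G a\<^esub> x a) ` carrier ?H)"
    proof (rule finite_subset)
      show "(\<lambda>x. \<lambda>a\<in>\<Delta>. P a a #>\<^bsub>G a\<^esub> x a) ` carrier ?H \<subseteq> (\<Pi>\<^sub>E a\<in>\<Delta>. rcosets\<^bsub>G a\<^esub> (P a a))"
        using \<Delta>I by (auto simp: subset_iff intro!: r_coset_in_rcosets H_closed)
      show "finite (\<Pi>\<^sub>E a\<in>\<Delta>. rcosets\<^bsub>G a\<^esub> (P a a))"
        using Psub finite_subset[OF \<Delta>I finite_I] by (intro finite_PiE) auto
    qed
    fix x y assume xy: "x \<in> carrier ?H" "y \<in> carrier ?H"
      and eq: "(\<lambda>a\<in>\<Delta>. P a a #>\<^bsub>G a\<^esub> x a) = (\<lambda>a\<in>\<Delta>. P a a #>\<^bsub>G a\<^esub> y a)"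
    then have H: "x \<in> H" "y \<in> H" by auto
    have "mul x (neg y) a \<in> P a a" if a: "a \<in> \<Delta>" for a
    proof -
      have aI: "a \<in> I" using a \<Delta>I by blast
      have "P a a #>\<^bsub>G a\<^esub> x a = P a a #>\<^bsub>G a\<^esub> y a"
        using fun_cong[OF eq, of a] a by simp
      then show ?thesis
        using group.r_coset_eq_iff[OF grp[OF aI] Psub(1)[OF a], of "x a" "y a"] H aI by simp
    qed
    then show "x \<otimes>\<^bsub>?H\<^esub> inv\<^bsub>?H\<^esub> y \<in> F"
      unfolding mul_eq inv_H[OF H(2)] using F_iff mul_H neg_H H by blast
  qed
  then have finF: "finite_index_subgroup (block_product I G \<Delta> block D) ?H"
    using subF by (simp add: finite_index_subgroup_def F_def)
  have "subgroup (D a) (product_group (block a) G)" for a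
    unfolding D_def N_def using block_restriction_subgroup[OF _ block_subset] by blast
  moreover have "finite_index_subgroup (P a a) (A a)" if "a \<in> \<Delta>" for a
    using fin[OF that block_self] that \<Delta>I finite_index_truncate by (auto simp: A_def)
  ultimately have groups: "\<forall>a\<in>\<Delta>. group (A a) \<and> finite_index_subgroup (P a a) (A a) \<and>
      subgroup (D a) (product_group (block a) G)"
    using grpA by simp
  have nonempty: "\<forall>a\<in>\<Delta>. block a \<noteq> {}"
    using block_self \<Delta>I by blast
  have isos: "\<forall>a\<in>\<Delta>. \<forall>i\<in>block a. G i \<cong> A a"
    using isoA by simp
  note diags = ballI[of \<Delta>, OF diag]
  show ?thesis
    unfolding virtually_diagonal_by_blocks_def
    by (intro conjI exI[of _ \<Delta>] exI[of _ block] exI[of _ A] exI[of _ "\<lambda>a. P a a"] exI[of _ D]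
        sub cover disj nonempty groups isos diags finF)
qed

end

theorem theorem2p15:
  fixes n :: nat
    and G :: "nat \<Rightarrow> ('a, 'b) monoid_scheme"
    and H :: "(nat \<Rightarrow> 'a) set"
  assumes "\<And>i. i \<in> {1..n} \<Longrightarrow> just_infinite (G i)"
    and "card {i \<in> {1..n}. virtually_abelian (G i)} \<le> 2"
    and "subdirect_product {1..n} G H"
  shows "virtually_diagonal_by_blocks {1..n} G H"
proof -
  interpret subdirect_just_infinite "{1..n}" G H
    using assms by unfold_locales auto
  show ?thesis using virtually_diagonal assms(2) .
qed

end
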